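(* An almost paracontact metric 3-dimensional Walker manifold $(M,\varphi,\xi,\eta,g)$ is paracontact metric if and only if the following conditions hold: $$\begin{cases}(\xi_2)_x-(\xi_3)_y=2\xi_3,\\ (\xi_1)_x+\xi_3f_x+f(\xi_3)_x-(\xi_3)_z=-2\xi_2,\\ (\xi_1)_y+\xi_3f_y+f(\xi_3)_y-(\xi_2)_z=2\xi_1.\end{cases}$$
   Context: An almost paracontact metric 3-dimensional Walker manifold $(M,\varphi,\xi,\eta,g)$ is a 3-manifold with coordinates $(x,y,z)$, $f\in C^\infty(M)$, and, with respect to $\{\partial_x,\partial_y,\partial_z\}$, $$g=\begin{pmatrix}0&0&1\\0&1&0\\1&0&f\end{pmatrix},\quad \varphi=\begin{pmatrix}-\xi_2&\xi_1+f\xi_3&-f\xi_2\\ \xi_3&0&-\xi_1\\0&-\xi_3&\xi_2\end{pmatrix},$$ $\xi=\xi_1\partial_x+\xi_2\partial_y+\xi_3\partial_z$, $\eta=\xi_3dx+\xi_2dy+(\xi_1+f\xi_3)dz$, where $\xi_1,\xi_2,\xi_3\in C^\infty(M)$ satisfy $\xi_2^2+f\xi_3^2+2\xi_1\xi_3=1$ (columns of $\varphi$ are the images of the basis vectors). Subscripts $x,y,z$ on functions denote partial derivatives. Let $\phi(X,Y)=g(\varphi X,Y)$ and $d\eta(X,Y)=\frac12((\nabla_X\eta)Y-(\nabla_Y\eta)X)$, $\nabla$ the Levi-Civita connection. The manifold is paracontact metric if $\phi=d\eta$. *)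

theory Defs
  imports "HOL-Analysis.Analysis"
begin

text \<open>
  The coordinates \<open>(x, y, z)\<close> identify the manifold with an open subset \<open>M\<close> of \<^typ>\<open>real^3\<close>.
  Functions and fields on \<open>M\<close> are total functions of which only the values on \<open>M\<close> matter.  Vector
  fields are given by their components with respect to \<open>\<partial>\<^sub>x, \<partial>\<^sub>y, \<partial>\<^sub>z\<close> and 1-forms by their components
  with respect to \<open>dx, dy, dz\<close>, so that the pairing of a 1-form with a vector is the inner
  product; the indices \<open>1, 2, 3 :: 3\<close> stand for \<open>x, y, z\<close>.
\<close>

definition coord_deriv :: "3 \<Rightarrow> (real^3 \<Rightarrow> real) \<Rightarrow> real^3 \<Rightarrow> real" where
  "coord_deriv i h p = frechet_derivative h (at p) (axis i 1)"

definition dir_deriv :: "(real^3 \<Rightarrow> real^3) \<Rightarrow> (real^3 \<Rightarrow> real) \<Rightarrow> real^3 \<Rightarrow> real" where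
  "dir_deriv X h p = frechet_derivative h (at p) (X p)"

fun Ck_on :: "nat \<Rightarrow> (real^3) set \<Rightarrow> (real^3 \<Rightarrow> real) \<Rightarrow> bool" where
  "Ck_on 0 M h \<longleftrightarrow> continuous_on M h"
| "Ck_on (Suc k) M h \<longleftrightarrow>
     (\<forall>p\<in>M. h differentiable (at p)) \<and> (\<forall>i. Ck_on k M (coord_deriv i h))"

definition smooth_on :: "(real^3) set \<Rightarrow> (real^3 \<Rightarrow> real) \<Rightarrow> bool" where
  "smooth_on M h \<longleftrightarrow> (\<forall>k. Ck_on k M h)"

definition vector_fields :: "(real^3) set \<Rightarrow> (real^3 \<Rightarrow> real^3) set" where
  "vector_fields M = {X. \<forall>i. smooth_on M (\<lambda>p. X p $ i)}"

definition lie_bracket :: "(real^3 \<Rightarrow> real^3) \<Rightarrow> (real^3 \<Rightarrow> real^3) \<Rightarrow> real^3 \<Rightarrow> real^3" where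
  "lie_bracket X Y p =
     (\<chi> k. dir_deriv X (\<lambda>q. Y q $ k) p - dir_deriv Y (\<lambda>q. X q $ k) p)"

definition affine_connection ::
    "(real^3) set \<Rightarrow> ((real^3 \<Rightarrow> real^3) \<Rightarrow> (real^3 \<Rightarrow> real^3) \<Rightarrow> real^3 \<Rightarrow> real^3) \<Rightarrow> bool" where
  "affine_connection M nabla \<longleftrightarrow>
     (\<forall>X\<in>vector_fields M. \<forall>Y\<in>vector_fields M. nabla X Y \<in> vector_fields M) \<and>
     (\<forall>X\<in>vector_fields M. \<forall>X'\<in>vector_fields M. \<forall>Y\<in>vector_fields M. \<forall>p\<in>M.
        nabla (\<lambda>q. X q + X' q) Y p = nabla X Y p + nabla X' Y p) \<and>
     (\<forall>h. smooth_on M h \<longrightarrow> (\<forall>X\<in>vector_fields M. \<forall>Y\<in>vector_fields M. \<forall>p\<in>M.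
        nabla (\<lambda>q. h q *\<^sub>R X q) Y p = h p *\<^sub>R nabla X Y p)) \<and>
     (\<forall>X\<in>vector_fields M. \<forall>Y\<in>vector_fields M. \<forall>Y'\<in>vector_fields M. \<forall>p\<in>M.
        nabla X (\<lambda>q. Y q + Y' q) p = nabla X Y p + nabla X Y' p) \<and>
     (\<forall>h. smooth_on M h \<longrightarrow> (\<forall>X\<in>vector_fields M. \<forall>Y\<in>vector_fields M. \<forall>p\<in>M.
        nabla X (\<lambda>q. h q *\<^sub>R Y q) p = dir_deriv X h p *\<^sub>R Y p + h p *\<^sub>R nabla X Y p))"

text \<open>The metric \<open>g\<close> is given by its Gram matrix with respect to \<open>\<partial>\<^sub>x, \<partial>\<^sub>y, \<partial>\<^sub>z\<close>.\<close>

definition metric_app :: "(real^3 \<Rightarrow> real^3^3) \<Rightarrow> real^3 \<Rightarrow> real^3 \<Rightarrow> real^3 \<Rightarrow> real" where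
  "metric_app g p v w = v \<bullet> (g p *v w)"

definition levi_civita ::
    "(real^3) set \<Rightarrow> (real^3 \<Rightarrow> real^3^3) \<Rightarrow>
     ((real^3 \<Rightarrow> real^3) \<Rightarrow> (real^3 \<Rightarrow> real^3) \<Rightarrow> real^3 \<Rightarrow> real^3) \<Rightarrow> bool" where
  "levi_civita M g nabla \<longleftrightarrow>
     affine_connection M nabla \<and>
     (\<forall>X\<in>vector_fields M. \<forall>Y\<in>vector_fields M. \<forall>p\<in>M.
        nabla X Y p - nabla Y X p = lie_bracket X Y p) \<and>
     (\<forall>X\<in>vector_fields M. \<forall>Y\<in>vector_fields M. \<forall>Z\<in>vector_fields M. \<forall>p\<in>M.
        dir_deriv X (\<lambda>q. metric_app g q (Y q) (Z q)) p =
          metric_app g p (nabla X Y p) (Z p) + metric_app g p (Y p) (nabla X Z p))"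

text \<open>\<open>(\<nabla>\<^sub>X \<eta>) Y = X (\<eta> Y) - \<eta> (\<nabla>\<^sub>X Y)\<close>.\<close>

definition cov_deriv_form ::
    "((real^3 \<Rightarrow> real^3) \<Rightarrow> (real^3 \<Rightarrow> real^3) \<Rightarrow> real^3 \<Rightarrow> real^3) \<Rightarrow> (real^3 \<Rightarrow> real^3) \<Rightarrow>
     (real^3 \<Rightarrow> real^3) \<Rightarrow> (real^3 \<Rightarrow> real^3) \<Rightarrow> real^3 \<Rightarrow> real" where
  "cov_deriv_form nabla \<eta> X Y p = dir_deriv X (\<lambda>q. \<eta> q \<bullet> Y q) p - \<eta> p \<bullet> nabla X Y p"

definition d_form ::
    "((real^3 \<Rightarrow> real^3) \<Rightarrow> (real^3 \<Rightarrow> real^3) \<Rightarrow> real^3 \<Rightarrow> real^3) \<Rightarrow> (real^3 \<Rightarrow> real^3) \<Rightarrow>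
     (real^3 \<Rightarrow> real^3) \<Rightarrow> (real^3 \<Rightarrow> real^3) \<Rightarrow> real^3 \<Rightarrow> real" where
  "d_form nabla \<eta> X Y p =
     (cov_deriv_form nabla \<eta> X Y p - cov_deriv_form nabla \<eta> Y X p) / 2"

definition fundamental_form ::
    "(real^3 \<Rightarrow> real^3^3) \<Rightarrow> (real^3 \<Rightarrow> real^3^3) \<Rightarrow>
     (real^3 \<Rightarrow> real^3) \<Rightarrow> (real^3 \<Rightarrow> real^3) \<Rightarrow> real^3 \<Rightarrow> real" where
  "fundamental_form g \<phi> X Y p = metric_app g p (\<phi> p *v X p) (Y p)"

definition paracontact_metric ::
    "(real^3) set \<Rightarrow> (real^3 \<Rightarrow> real^3^3) \<Rightarrow> (real^3 \<Rightarrow> real^3) \<Rightarrow> (real^3 \<Rightarrow> real^3^3) \<Rightarrow>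
     ((real^3 \<Rightarrow> real^3) \<Rightarrow> (real^3 \<Rightarrow> real^3) \<Rightarrow> real^3 \<Rightarrow> real^3) \<Rightarrow> bool" where
  "paracontact_metric M \<phi> \<eta> g nabla \<longleftrightarrow>
     (\<forall>X\<in>vector_fields M. \<forall>Y\<in>vector_fields M. \<forall>p\<in>M.
        fundamental_form g \<phi> X Y p = d_form nabla \<eta> X Y p)"

text \<open>The inner lists below are the rows of the matrices.\<close>

definition walker_metric :: "(real^3 \<Rightarrow> real) \<Rightarrow> real^3 \<Rightarrow> real^3^3" where
  "walker_metric f p = vector [vector [0, 0, 1], vector [0, 1, 0], vector [1, 0, f p]]"

definition walker_phi ::
    "(real^3 \<Rightarrow> real) \<Rightarrow> (real^3 \<Rightarrow> real) \<Rightarrow> (real^3 \<Rightarrow> real) \<Rightarrow> (real^3 \<Rightarrow> real) \<Rightarrow>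
     real^3 \<Rightarrow> real^3^3" where
  "walker_phi f \<xi>1 \<xi>2 \<xi>3 p = vector
     [vector [- \<xi>2 p, \<xi>1 p + f p * \<xi>3 p, - f p * \<xi>2 p],
      vector [\<xi>3 p, 0, - \<xi>1 p],
      vector [0, - \<xi>3 p, \<xi>2 p]]"

definition walker_xi ::
    "(real^3 \<Rightarrow> real) \<Rightarrow> (real^3 \<Rightarrow> real) \<Rightarrow> (real^3 \<Rightarrow> real) \<Rightarrow> real^3 \<Rightarrow> real^3" where
  "walker_xi \<xi>1 \<xi>2 \<xi>3 p = vector [\<xi>1 p, \<xi>2 p, \<xi>3 p]"

definition walker_eta ::
    "(real^3 \<Rightarrow> real) \<Rightarrow> (real^3 \<Rightarrow> real) \<Rightarrow> (real^3 \<Rightarrow> real) \<Rightarrow> (real^3 \<Rightarrow> real) \<Rightarrow>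
     real^3 \<Rightarrow> real^3" where
  "walker_eta f \<xi>1 \<xi>2 \<xi>3 p = vector [\<xi>3 p, \<xi>2 p, \<xi>1 p + f p * \<xi>3 p]"

definition almost_paracontact_metric_walker ::
    "(real^3) set \<Rightarrow> (real^3 \<Rightarrow> real^3^3) \<Rightarrow> (real^3 \<Rightarrow> real^3) \<Rightarrow> (real^3 \<Rightarrow> real^3) \<Rightarrow>
     (real^3 \<Rightarrow> real^3^3) \<Rightarrow>
     (real^3 \<Rightarrow> real) \<Rightarrow> (real^3 \<Rightarrow> real) \<Rightarrow> (real^3 \<Rightarrow> real) \<Rightarrow> (real^3 \<Rightarrow> real) \<Rightarrow> bool" where
  "almost_paracontact_metric_walker M \<phi> \<xi> \<eta> g f \<xi>1 \<xi>2 \<xi>3 \<longleftrightarrow>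
     open M \<and> smooth_on M f \<and> smooth_on M \<xi>1 \<and> smooth_on M \<xi>2 \<and> smooth_on M \<xi>3 \<and>
     (\<forall>p\<in>M. (\<xi>2 p)\<^sup>2 + f p * (\<xi>3 p)\<^sup>2 + 2 * \<xi>1 p * \<xi>3 p = 1) \<and>
     g = walker_metric f \<and> \<phi> = walker_phi f \<xi>1 \<xi>2 \<xi>3 \<and>
     \<xi> = walker_xi \<xi>1 \<xi>2 \<xi>3 \<and> \<eta> = walker_eta f \<xi>1 \<xi>2 \<xi>3"

lemma metric_app_walker:
  "metric_app (walker_metric f) p v w =
     v $ 1 * w $ 3 + v $ 2 * w $ 2 + v $ 3 * w $ 1 + f p * v $ 3 * w $ 3"
  by (simp add: metric_app_def walker_metric_def inner_vec_def matrix_vector_mult_def sum_3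
      vector_3 algebra_simps)

lemma almost_paracontact_metric_walker_axioms:
  assumes "almost_paracontact_metric_walker M \<phi> \<xi> \<eta> g f \<xi>1 \<xi>2 \<xi>3" "p \<in> M"
  shows "\<eta> p \<bullet> \<xi> p = 1"
    and "\<phi> p *v (\<phi> p *v v) = v - (\<eta> p \<bullet> v) *\<^sub>R \<xi> p"
    and "\<eta> p \<bullet> v = metric_app g p (\<xi> p) v"
    and "metric_app g p (\<phi> p *v v) (\<phi> p *v w) =
           - metric_app g p v w + (\<eta> p \<bullet> v) * (\<eta> p \<bullet> w)"
proof -
  have defs: "g = walker_metric f" "\<phi> = walker_phi f \<xi>1 \<xi>2 \<xi>3" "\<xi> = walker_xi \<xi>1 \<xi>2 \<xi>3"
      "\<eta> = walker_eta f \<xi>1 \<xi>2 \<xi>3"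
    and c: "(\<xi>2 p)\<^sup>2 + f p * (\<xi>3 p)\<^sup>2 + 2 * \<xi>1 p * \<xi>3 p = 1"
    using assms by (auto simp: almost_paracontact_metric_walker_def)
  note unf = defs metric_app_walker walker_phi_def walker_xi_def walker_eta_def inner_vec_def
    matrix_vector_mult_def sum_3 vector_3
  show "\<eta> p \<bullet> \<xi> p = 1"
    using c by (simp add: unf algebra_simps power2_eq_square)
  show flat: "\<eta> p \<bullet> v = metric_app g p (\<xi> p) v" for v
    by (simp add: unf algebra_simps)
  show square: "\<phi> p *v (\<phi> p *v v) = v - (\<eta> p \<bullet> v) *\<^sub>R \<xi> p" for v
    unfolding vec_eq_iff forall_3 using c by (simp add: unf; algebra)
  have skew: "metric_app g p (\<phi> p *v v) u = - metric_app g p v (\<phi> p *v u)" for u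
    by (simp add: unf algebra_simps)
  have "metric_app g p (\<phi> p *v v) (\<phi> p *v w) = - metric_app g p v (w - (\<eta> p \<bullet> w) *\<^sub>R \<xi> p)"
    by (simp only: skew square)
  also have "\<dots> = - metric_app g p v w + metric_app g p (\<xi> p) v * (\<eta> p \<bullet> w)"
    unfolding defs metric_app_walker by (simp add: algebra_simps)
  finally show "metric_app g p (\<phi> p *v v) (\<phi> p *v w) =
      - metric_app g p v w + (\<eta> p \<bullet> v) * (\<eta> p \<bullet> w)"
    by (simp only: flat)
qed

lemma smooth_on_differentiable: "smooth_on M h \<Longrightarrow> p \<in> M \<Longrightarrow> h differentiable (at p)"
  unfolding smooth_on_def by (metis Ck_on.simps(2))

lemma smooth_on_coord_deriv: "smooth_on M h \<Longrightarrow> smooth_on M (coord_deriv i h)"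
  unfolding smooth_on_def by (metis Ck_on.simps(2))

lemma frechet_derivative_cong_open:
  fixes h h' :: "real^3 \<Rightarrow> real"
  assumes "open M" "\<And>q. q \<in> M \<Longrightarrow> h q = h' q" "p \<in> M"
  shows "frechet_derivative h (at p) = frechet_derivative h' (at p)"
proof -
  have "(h has_derivative D) (at p) \<longleftrightarrow> (h' has_derivative D) (at p)" for D
    using has_derivative_transform_within_open[OF _ assms(1,3), of h D UNIV h']
      has_derivative_transform_within_open[OF _ assms(1,3), of h' D UNIV h] assms(2) by auto
  then show ?thesis by (simp add: frechet_derivative_def)
qed

lemma Ck_on_cong:
  assumes "open M" "\<And>q. q \<in> M \<Longrightarrow> h q = h' q" "Ck_on k M h"
  shows "Ck_on k M h'"
  using assms(2,3)
proof (induction k arbitrary: h h')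
  case 0
  then show ?case using continuous_on_cong by force
next
  case (Suc k)
  have "h' differentiable (at p)" if "p \<in> M" for p
    using that Suc.prems assms(1) has_derivative_transform_within_open
    unfolding differentiable_def Ck_on.simps by metis
  moreover have "coord_deriv i h q = coord_deriv i h' q" if "q \<in> M" for i q
    using frechet_derivative_cong_open[OF assms(1) Suc.prems(1) that]
    by (simp add: coord_deriv_def)
  moreover have "Ck_on k M (coord_deriv i h')"
    if "\<And>q. q \<in> M \<Longrightarrow> coord_deriv i h q = coord_deriv i h' q" for i
    by (rule Suc.IH[OF that]) (use Suc.prems(2) in simp_all)
  ultimately show ?case by simp
qed

lemma Ck_on_Suc_imp: "Ck_on (Suc k) M h \<Longrightarrow> Ck_on k M h"
proof (induction k arbitrary: h)
  case 0
  then show ?case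
    by (auto intro!: continuous_at_imp_continuous_on differentiable_imp_continuous_within)
next
  case (Suc k)
  then show ?case by simp
qed

lemma Ck_on_const: "Ck_on k M (\<lambda>q. c)"
proof (induction k arbitrary: c)
  case (Suc k)
  have "coord_deriv i (\<lambda>q. c) = (\<lambda>q. 0)" for i
    by (simp add: coord_deriv_def fun_eq_iff)
  with Suc show ?case by simp
qed simp

lemma frechet_derivative_add':
  fixes h h' :: "real^3 \<Rightarrow> real"
  assumes "h differentiable (at p)" "h' differentiable (at p)"
  shows "frechet_derivative (\<lambda>q. h q + h' q) (at p) v =
     frechet_derivative h (at p) v + frechet_derivative h' (at p) v"
proof -
  have "((\<lambda>q. h q + h' q) has_derivative
      (\<lambda>v. frechet_derivative h (at p) v + frechet_derivative h' (at p) v)) (at p)"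
    by (intro has_derivative_add assms[unfolded frechet_derivative_works])
  from frechet_derivative_at[OF this, symmetric] show ?thesis by (rule fun_cong)
qed

lemma coord_deriv_add:
  assumes "h differentiable (at p)" "h' differentiable (at p)"
  shows "coord_deriv i (\<lambda>q. h q + h' q) p = coord_deriv i h p + coord_deriv i h' p"
  using frechet_derivative_add'[OF assms] by (simp add: coord_deriv_def)

lemma dir_deriv_add:
  assumes "h differentiable (at p)" "h' differentiable (at p)"
  shows "dir_deriv X (\<lambda>q. h q + h' q) p = dir_deriv X h p + dir_deriv X h' p"
  using frechet_derivative_add'[OF assms] by (simp add: dir_deriv_def)

lemma frechet_derivative_mult':
  fixes h h' :: "real^3 \<Rightarrow> real"
  assumes "h differentiable (at p)" "h' differentiable (at p)"
  shows "frechet_derivative (\<lambda>q. h q * h' q) (at p) v =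
     h p * frechet_derivative h' (at p) v + frechet_derivative h (at p) v * h' p"
proof -
  have "((\<lambda>q. h q * h' q) has_derivative
      (\<lambda>v. h p * frechet_derivative h' (at p) v + frechet_derivative h (at p) v * h' p)) (at p)"
    by (intro has_derivative_mult assms[unfolded frechet_derivative_works])
  from frechet_derivative_at[OF this, symmetric] show ?thesis by (rule fun_cong)
qed

lemma coord_deriv_mult:
  assumes "h differentiable (at p)" "h' differentiable (at p)"
  shows "coord_deriv i (\<lambda>q. h q * h' q) p = h p * coord_deriv i h' p + coord_deriv i h p * h' p"
  using frechet_derivative_mult'[OF assms] by (simp add: coord_deriv_def)

lemma dir_deriv_mult:
  assumes "h differentiable (at p)" "h' differentiable (at p)"
  shows "dir_deriv X (\<lambda>q. h q * h' q) p = h p * dir_deriv X h' p + dir_deriv X h p * h' p"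
  using frechet_derivative_mult'[OF assms] by (simp add: dir_deriv_def)

lemma Ck_on_add:
  assumes "open M"
  shows "Ck_on k M h \<Longrightarrow> Ck_on k M h' \<Longrightarrow> Ck_on k M (\<lambda>q. h q + h' q)"
proof (induction k arbitrary: h h')
  case 0
  then show ?case by (auto intro: continuous_intros)
next
  case (Suc k)
  have "Ck_on k M (coord_deriv i (\<lambda>q. h q + h' q))" for i
    by (rule Ck_on_cong[OF assms, of "\<lambda>q. coord_deriv i h q + coord_deriv i h' q"])
       (use Suc in \<open>auto simp: coord_deriv_add\<close>)
  with Suc.prems show ?case by simp
qed

lemma Ck_on_mult:
  assumes "open M"
  shows "Ck_on k M h \<Longrightarrow> Ck_on k M h' \<Longrightarrow> Ck_on k M (\<lambda>q. h q * h' q)"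
proof (induction k arbitrary: h h')
  case 0
  then show ?case by (auto intro: continuous_intros)
next
  case (Suc k)
  have "Ck_on k M (\<lambda>q. h q * coord_deriv i h' q + coord_deriv i h q * h' q)" for i
    using Suc.prems Ck_on_Suc_imp[OF Suc.prems(1)] Ck_on_Suc_imp[OF Suc.prems(2)]
    by (intro Ck_on_add[OF assms] Suc.IH) (simp_all del: Ck_on.simps(1))
  then have "Ck_on k M (coord_deriv i (\<lambda>q. h q * h' q))" for i
    by (rule Ck_on_cong[OF assms, rotated]) (use Suc.prems in \<open>auto simp: coord_deriv_mult\<close>)
  with Suc.prems show ?case by simp
qed

lemma smooth_on_const: "smooth_on M (\<lambda>q. c)"
  by (simp add: smooth_on_def Ck_on_const)

lemma smooth_on_add:
  "open M \<Longrightarrow> smooth_on M h \<Longrightarrow> smooth_on M h' \<Longrightarrow> smooth_on M (\<lambda>q. h q + h' q)"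
  by (simp add: smooth_on_def Ck_on_add)

lemma smooth_on_mult:
  "open M \<Longrightarrow> smooth_on M h \<Longrightarrow> smooth_on M h' \<Longrightarrow> smooth_on M (\<lambda>q. h q * h' q)"
  by (simp add: smooth_on_def Ck_on_mult)

lemma smooth_on_cong:
  "open M \<Longrightarrow> (\<And>q. q \<in> M \<Longrightarrow> h q = h' q) \<Longrightarrow> smooth_on M h \<Longrightarrow> smooth_on M h'"
  unfolding smooth_on_def using Ck_on_cong by blast

lemma dir_deriv_eq_sum:
  assumes "h differentiable (at p)"
  shows "dir_deriv X h p =
    X p $ 1 * coord_deriv 1 h p + X p $ 2 * coord_deriv 2 h p + X p $ 3 * coord_deriv 3 h p"
proof -
  interpret linear "frechet_derivative h (at p)"
    by (rule linear_frechet_derivative[OF assms])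
  have "X p = X p $ 1 *\<^sub>R axis 1 1 + X p $ 2 *\<^sub>R axis 2 1 + X p $ 3 *\<^sub>R axis 3 1"
    by (simp add: vec_eq_iff forall_3 axis_def)
  then have "frechet_derivative h (at p) (X p) =
      frechet_derivative h (at p) (X p $ 1 *\<^sub>R axis 1 1 + X p $ 2 *\<^sub>R axis 2 1 + X p $ 3 *\<^sub>R axis 3 1)"
    by simp
  then show ?thesis by (simp add: dir_deriv_def coord_deriv_def add scaleR)
qed

lemma smooth_on_dir_deriv:
  assumes "open M" "X \<in> vector_fields M" "smooth_on M h"
  shows "smooth_on M (dir_deriv X h)"
proof (rule smooth_on_cong[OF assms(1)])
  show "smooth_on M (\<lambda>p. X p $ 1 * coord_deriv 1 h p + X p $ 2 * coord_deriv 2 h p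
      + X p $ 3 * coord_deriv 3 h p)"
    using assms by (intro smooth_on_add smooth_on_mult smooth_on_coord_deriv)
      (auto simp: vector_fields_def)
qed (use assms smooth_on_differentiable dir_deriv_eq_sum in metis)

text \<open>
  The connection obtained from the Christoffel symbols of the Walker metric: its existence shows
  that \<^const>\<open>levi_civita\<close> is satisfiable for every smooth \<open>f\<close>.
\<close>

definition walker_nabla ::
    "(real^3 \<Rightarrow> real) \<Rightarrow> (real^3 \<Rightarrow> real^3) \<Rightarrow> (real^3 \<Rightarrow> real^3) \<Rightarrow> real^3 \<Rightarrow> real^3" where
  "walker_nabla f X Y p = vector
     [dir_deriv X (\<lambda>q. Y q $ 1) p
        + 1 / 2 * (dir_deriv X f p * Y p $ 3 + dir_deriv Y f p * X p $ 3
                   + (f p * coord_deriv 1 f p + - 1 * coord_deriv 3 f p) * (X p $ 3 * Y p $ 3)),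
      dir_deriv X (\<lambda>q. Y q $ 2) p + - 1 / 2 * (coord_deriv 2 f p * (X p $ 3 * Y p $ 3)),
      dir_deriv X (\<lambda>q. Y q $ 3) p + - 1 / 2 * (coord_deriv 1 f p * (X p $ 3 * Y p $ 3))]"

lemma levi_civita_walker_nabla:
  assumes M: "open M" and f: "smooth_on M f"
  shows "levi_civita M (walker_metric f) (walker_nabla f)"
proof -
  have comp: "smooth_on M (\<lambda>q. X q $ i)" if "X \<in> vector_fields M" for X i
    using that by (simp add: vector_fields_def)
  note d = smooth_on_differentiable[OF comp] smooth_on_differentiable[OF f]
  have lin: "dir_deriv (\<lambda>q. X q + X' q) h p = dir_deriv X h p + dir_deriv X' h p"
      "dir_deriv (\<lambda>q. a q *\<^sub>R X q) h p = a p * dir_deriv X h p"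
    if "h differentiable (at p)" for X X' h p and a :: "real^3 \<Rightarrow> real"
    using linear_frechet_derivative[OF that] by (simp_all add: dir_deriv_def linear_add linear_scale)
  have closed: "walker_nabla f X Y \<in> vector_fields M"
    if X: "X \<in> vector_fields M" and Y: "Y \<in> vector_fields M" for X Y
    unfolding vector_fields_def mem_Collect_eq forall_3 walker_nabla_def vector_3
    by (intro conjI smooth_on_add[OF M] smooth_on_mult[OF M] smooth_on_const comp X Y f
        smooth_on_coord_deriv smooth_on_dir_deriv[OF M])
  have addX: "walker_nabla f (\<lambda>q. X q + X' q) Y p = walker_nabla f X Y p + walker_nabla f X' Y p"
    if "X \<in> vector_fields M" "X' \<in> vector_fields M" "Y \<in> vector_fields M" "p \<in> M" for X X' Y p
    using that by (simp add: vec_eq_iff forall_3 walker_nabla_def vector_3 lin d field_simps)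
  have scaleX: "walker_nabla f (\<lambda>q. h q *\<^sub>R X q) Y p = h p *\<^sub>R walker_nabla f X Y p"
    if "smooth_on M h" "X \<in> vector_fields M" "Y \<in> vector_fields M" "p \<in> M" for h X Y p
    using that by (simp add: vec_eq_iff forall_3 walker_nabla_def vector_3 lin d field_simps)
  have addY: "walker_nabla f X (\<lambda>q. Y q + Y' q) p = walker_nabla f X Y p + walker_nabla f X Y' p"
    if "X \<in> vector_fields M" "Y \<in> vector_fields M" "Y' \<in> vector_fields M" "p \<in> M" for X Y Y' p
    using that by (simp add: vec_eq_iff forall_3 walker_nabla_def vector_3 lin d dir_deriv_add
        field_simps)
  have leibniz: "walker_nabla f X (\<lambda>q. h q *\<^sub>R Y q) p =
      dir_deriv X h p *\<^sub>R Y p + h p *\<^sub>R walker_nabla f X Y p"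
    if "smooth_on M h" "X \<in> vector_fields M" "Y \<in> vector_fields M" "p \<in> M" for h X Y p
    using that by (simp add: vec_eq_iff forall_3 walker_nabla_def vector_3 lin d dir_deriv_mult
        smooth_on_differentiable[OF that(1)] field_simps)
  have torsion: "walker_nabla f X Y p - walker_nabla f Y X p = lie_bracket X Y p" for X Y p
    by (simp add: vec_eq_iff forall_3 walker_nabla_def lie_bracket_def vector_3 field_simps)
  have compat: "dir_deriv X (\<lambda>q. metric_app (walker_metric f) q (Y q) (Z q)) p =
      metric_app (walker_metric f) p (walker_nabla f X Y p) (Z p) +
      metric_app (walker_metric f) p (Y p) (walker_nabla f X Z p)"
    if "X \<in> vector_fields M" "Y \<in> vector_fields M" "Z \<in> vector_fields M" "p \<in> M" for X Y Z p
  proof -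
    note dY = d(1)[OF that(2,4)] and dZ = d(1)[OF that(3,4)] and df = d(2)[OF that(4)]
    have lhs: "dir_deriv X (\<lambda>q. metric_app (walker_metric f) q (Y q) (Z q)) p =
        (Y p $ 1 * dir_deriv X (\<lambda>q. Z q $ 3) p + dir_deriv X (\<lambda>q. Y q $ 1) p * Z p $ 3)
      + (Y p $ 2 * dir_deriv X (\<lambda>q. Z q $ 2) p + dir_deriv X (\<lambda>q. Y q $ 2) p * Z p $ 2)
      + (Y p $ 3 * dir_deriv X (\<lambda>q. Z q $ 1) p + dir_deriv X (\<lambda>q. Y q $ 3) p * Z p $ 1)
      + (f p * Y p $ 3 * dir_deriv X (\<lambda>q. Z q $ 3) p
         + (f p * dir_deriv X (\<lambda>q. Y q $ 3) p + dir_deriv X f p * Y p $ 3) * Z p $ 3)"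
      unfolding metric_app_walker
      by (simp add: dir_deriv_add dir_deriv_mult differentiable_add differentiable_mult dY dZ df)
    show ?thesis
      unfolding lhs unfolding metric_app_walker walker_nabla_def vector_3
        dir_deriv_eq_sum[OF df, of Y] dir_deriv_eq_sum[OF df, of Z]
      by algebra
  qed
  show ?thesis
    unfolding levi_civita_def affine_connection_def
    by (intro conjI ballI allI impI)
      (assumption | rule closed addX scaleX addY leibniz torsion compat)+
qed

end

theory Submission
  imports Defs
begin

text \<open>The condition equates two alternating bilinear forms in X p and Y p, so it amounts to
  comparing their coefficients on dx^dy, dx^dz and dy^dz. Since the connection is torsion-free, 2
  \<open>d_form\<close> is X(\<eta> Y) - Y(\<eta> X) - \<eta>[X,Y], the classical exterior
  derivative; \<open>d_form_coord\<close> computes its coefficients D i j.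
  \<open>fundamental_form_walker\<close> gives \<xi>3, -\<xi>2, \<xi>1 for the other form. Twice
  these are the right-hand sides of the three equations; the D i j for \<eta> = (\<xi>3, \<xi>2,
  \<xi>1 + f \<xi>3) are the left-hand sides.\<close>

lemma d_form_coord:
  assumes lc: "levi_civita M g nabla"
    and X: "X \<in> vector_fields M" and Y: "Y \<in> vector_fields M" and p: "p \<in> M"
    and \<eta>: "\<And>i. (\<lambda>q. \<eta> q $ i) differentiable (at p)"
  defines "D \<equiv> \<lambda>i j. coord_deriv i (\<lambda>q. \<eta> q $ j) p - coord_deriv j (\<lambda>q. \<eta> q $ i) p"
  shows "2 * d_form nabla \<eta> X Y p =
    D 1 2 * (X p $ 1 * Y p $ 2 - X p $ 2 * Y p $ 1) +
    D 1 3 * (X p $ 1 * Y p $ 3 - X p $ 3 * Y p $ 1) +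
    D 2 3 * (X p $ 2 * Y p $ 3 - X p $ 3 * Y p $ 2)"
proof -
  \<comment> \<open>The connection enters \<open>d_form\<close> only through this antisymmetrised
    term, which torsion-freeness turns into a bracket.\<close>
  have torsion: "\<eta> p \<bullet> nabla X Y p - \<eta> p \<bullet> nabla Y X p = \<eta> p \<bullet> lie_bracket X Y p"
    using lc X Y p unfolding levi_civita_def by (metis inner_diff_right)
  have comp: "(\<lambda>q. Z q $ i) differentiable (at p)" if "Z \<in> vector_fields M" for Z i
    using that p by (auto simp: vector_fields_def intro: smooth_on_differentiable)
  have leibniz: "dir_deriv V (\<lambda>q. \<eta> q \<bullet> W q) p =
      (\<eta> p $ 1 * dir_deriv V (\<lambda>q. W q $ 1) p + dir_deriv V (\<lambda>q. \<eta> q $ 1) p * W p $ 1) +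
      (\<eta> p $ 2 * dir_deriv V (\<lambda>q. W q $ 2) p + dir_deriv V (\<lambda>q. \<eta> q $ 2) p * W p $ 2) +
      (\<eta> p $ 3 * dir_deriv V (\<lambda>q. W q $ 3) p + dir_deriv V (\<lambda>q. \<eta> q $ 3) p * W p $ 3)"
    if "W \<in> vector_fields M" for V W
    by (simp add: inner_vec_def sum_3 dir_deriv_add dir_deriv_mult differentiable_add
        differentiable_mult \<eta> comp[OF that])
  have "2 * d_form nabla \<eta> X Y p = dir_deriv X (\<lambda>q. \<eta> q \<bullet> Y q) p
      - dir_deriv Y (\<lambda>q. \<eta> q \<bullet> X q) p - \<eta> p \<bullet> lie_bracket X Y p"
    using torsion by (simp add: d_form_def cov_deriv_form_def)
  then show ?thesis
    \<comment> \<open>The derivatives of the components of X and Y cancel against the bracket; only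
      derivatives of \<eta> survive.\<close>
    unfolding leibniz[OF X] leibniz[OF Y] dir_deriv_eq_sum[OF \<eta>] D_def
    by (simp add: inner_vec_def sum_3 lie_bracket_def algebra_simps)
qed

text \<open>This is det(\<xi>, X, Y), the contraction of dx^dy^dz with \<xi>. It is written in the
  same minors as \<open>d_form_coord\<close>, so that coefficients can be compared.\<close>

lemma fundamental_form_walker:
  "fundamental_form (walker_metric f) (walker_phi f \<xi>1 \<xi>2 \<xi>3) X Y p =
    \<xi>3 p * (X p $ 1 * Y p $ 2 - X p $ 2 * Y p $ 1) -
    \<xi>2 p * (X p $ 1 * Y p $ 3 - X p $ 3 * Y p $ 1) +
    \<xi>1 p * (X p $ 2 * Y p $ 3 - X p $ 3 * Y p $ 2)"
  by (simp add: fundamental_form_def metric_app_walker walker_phi_def matrix_vector_mult_def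
      sum_3 vector_3 algebra_simps)

text \<open>Constant fields suffice as test fields, because both forms at p depend only on X p and Y
  p.\<close>

lemma const_in_vector_fields: "(\<lambda>q. v) \<in> vector_fields M"
  by (simp add: vector_fields_def smooth_on_const)

theorem proposition4p1:
  fixes M :: "(real^3) set"
    and \<phi> g :: "real^3 \<Rightarrow> real^3^3"
    and \<xi> \<eta> :: "real^3 \<Rightarrow> real^3"
    and f \<xi>1 \<xi>2 \<xi>3 :: "real^3 \<Rightarrow> real"
    and nabla :: "(real^3 \<Rightarrow> real^3) \<Rightarrow> (real^3 \<Rightarrow> real^3) \<Rightarrow> real^3 \<Rightarrow> real^3"
  assumes "almost_paracontact_metric_walker M \<phi> \<xi> \<eta> g f \<xi>1 \<xi>2 \<xi>3"
    and "levi_civita M g nabla"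
  shows "paracontact_metric M \<phi> \<eta> g nabla \<longleftrightarrow>
    (\<forall>p\<in>M.
       coord_deriv 1 \<xi>2 p - coord_deriv 2 \<xi>3 p = 2 * \<xi>3 p \<and>
       coord_deriv 1 \<xi>1 p + \<xi>3 p * coord_deriv 1 f p + f p * coord_deriv 1 \<xi>3 p
         - coord_deriv 3 \<xi>3 p = - 2 * \<xi>2 p \<and>
       coord_deriv 2 \<xi>1 p + \<xi>3 p * coord_deriv 2 f p + f p * coord_deriv 2 \<xi>3 p
         - coord_deriv 3 \<xi>2 p = 2 * \<xi>1 p)"
    (is "_ \<longleftrightarrow> (\<forall>p\<in>M. ?A p = _ \<and> ?B p = _ \<and> ?C p = _)")
proof -
  have smooth: "smooth_on M f" "smooth_on M \<xi>1" "smooth_on M \<xi>2" "smooth_on M \<xi>3"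
    and defs: "g = walker_metric f" "\<phi> = walker_phi f \<xi>1 \<xi>2 \<xi>3" "\<eta> = walker_eta f \<xi>1 \<xi>2 \<xi>3"
    using assms(1) by (auto simp: almost_paracontact_metric_walker_def)
  have eta: "(\<lambda>q. \<eta> q $ 1) = \<xi>3" "(\<lambda>q. \<eta> q $ 2) = \<xi>2" "(\<lambda>q. \<eta> q $ 3) = (\<lambda>q. \<xi>1 q + f q * \<xi>3 q)"
    by (simp_all add: defs walker_eta_def vector_3)
  \<comment> \<open>The product rule on the third component of \<eta> produces the terms in f and
    its derivatives in \<open>?B\<close> and \<open>?C\<close>.\<close>
  have d_form: "2 * d_form nabla \<eta> X Y p =
      ?A p * (X p $ 1 * Y p $ 2 - X p $ 2 * Y p $ 1) +
      ?B p * (X p $ 1 * Y p $ 3 - X p $ 3 * Y p $ 1) +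
      ?C p * (X p $ 2 * Y p $ 3 - X p $ 3 * Y p $ 2)"
    if "X \<in> vector_fields M" "Y \<in> vector_fields M" "p \<in> M" for X Y p
  proof -
    note d = smooth[THEN smooth_on_differentiable, OF that(3)]
    have "\<forall>i. (\<lambda>q. \<eta> q $ i) differentiable (at p)"
      unfolding forall_3 eta by (intro conjI differentiable_add differentiable_mult d)
    then show ?thesis
      using d_form_coord[OF assms(2) that, of \<eta>] d
      by (simp add: eta coord_deriv_add coord_deriv_mult differentiable_mult algebra_simps)
  qed
  show ?thesis
  proof (intro iffI ballI)
    fix p assume p: "p \<in> M" and pc: "paracontact_metric M \<phi> \<eta> g nabla"
    have eq: "fundamental_form g \<phi> (\<lambda>q. v) (\<lambda>q. w) p = d_form nabla \<eta> (\<lambda>q. v) (\<lambda>q. w) p" for v w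
      using pc p const_in_vector_fields unfolding paracontact_metric_def by blast
    note basis = d_form[OF const_in_vector_fields const_in_vector_fields p,
        folded eq, unfolded defs fundamental_form_walker]
    show "?A p = 2 * \<xi>3 p \<and> ?B p = - 2 * \<xi>2 p \<and> ?C p = 2 * \<xi>1 p"
      \<comment> \<open>For each pair of distinct basis vectors one minor is 1 and the other two
        vanish, which isolates one coefficient.\<close>
      using basis[of "axis 1 1" "axis 2 1"] basis[of "axis 1 1" "axis 3 1"]
        basis[of "axis 2 1" "axis 3 1"]
      by (simp add: axis_def)
  next
    assume *: "\<forall>p\<in>M. ?A p = 2 * \<xi>3 p \<and> ?B p = - 2 * \<xi>2 p \<and> ?C p = 2 * \<xi>1 p"
    have "fundamental_form g \<phi> X Y p = d_form nabla \<eta> X Y p"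
      if "X \<in> vector_fields M" "Y \<in> vector_fields M" "p \<in> M" for X Y p
    proof -
      have abc: "?A p = 2 * \<xi>3 p" "?B p = - 2 * \<xi>2 p" "?C p = 2 * \<xi>1 p"
        using * that(3) by blast+
      \<comment> \<open>With these values, the expansion of 2 \<open>d_form\<close> is exactly twice
        that of \<open>fundamental_form\<close>.\<close>
      show ?thesis
        using d_form[OF that] unfolding abc defs fundamental_form_walker by (simp add: algebra_simps)
    qed
    then show "paracontact_metric M \<phi> \<eta> g nabla"
      unfolding paracontact_metric_def by blast
  qed
qed

end
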